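(* No $\Phi$-functional is countably based.
   Context: Reals are represented by fast-converging Cauchy sequences of rationals. A set of reals is given by a function $Y:\mathbb{R}\to\mathbb{R}$ (a type-2 object), where $x\in Y$ means $Y(x)>0$; $Y$ is open if for every $x\in Y$ there is a rational $r>0$ with $B(x,r)=\{y:|x-y|<r\}\subseteq Y$. A $\Phi$-functional is any type-3 functional $\Phi$ such that for every open set $Y\subseteq\mathbb{R}$ and every real $x\in Y$, $\Phi(Y,x)$ is a rational $r>0$ with $B(x,r)\subseteq Y$. A type-3 functional $\Phi$ is countably based if for every type-2 input $F$ there is a countable set $X\subseteq\mathbb{N}^{\mathbb{N}}$ such that $\Phi(F)=\Phi(G)$ for every $G$ that agrees with $F$ on $X$ (here inputs $(Y,x)$ are coded as a single type-2 object, with $x$ fixed). Metatheory ZFC. *)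

theory Defs
  imports "HOL-Analysis.Analysis" "HOL-Library.Countable"
begin

type_synonym type1 = "nat \<Rightarrow> nat"
type_synonym type2 = "type1 \<Rightarrow> nat"

(* Rationals are coded by naturals through the library surjection nat_to_rat_surj, so that an
   element of Baire space is a sequence of rationals. *)
definition rat_seq :: "type1 \<Rightarrow> nat \<Rightarrow> rat" where
  "rat_seq x n = nat_to_rat_surj (x n)"

definition is_real :: "type1 \<Rightarrow> bool" where
  "is_real x \<longleftrightarrow> (\<forall>n i. \<bar>rat_seq x n - rat_seq x (n + i)\<bar> < 1 / 2 ^ n)"

definition real_val :: "type1 \<Rightarrow> real" where
  "real_val x = lim (\<lambda>n. of_rat (rat_seq x n))"

(* A function from reals to reals is an operation on Baire space that maps codes of reals to
   codes of reals and respects equality of the coded reals. *)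
definition real_function :: "(type1 \<Rightarrow> type1) \<Rightarrow> bool" where
  "real_function Y \<longleftrightarrow>
     (\<forall>x. is_real x \<longrightarrow> is_real (Y x)) \<and>
     (\<forall>x y. is_real x \<longrightarrow> is_real y \<longrightarrow> real_val x = real_val y \<longrightarrow>
        real_val (Y x) = real_val (Y y))"

definition real_set :: "(type1 \<Rightarrow> type1) \<Rightarrow> real set" where
  "real_set Y = {real_val x | x. is_real x \<and> real_val (Y x) > 0}"

definition open_set :: "(type1 \<Rightarrow> type1) \<Rightarrow> bool" where
  "open_set Y \<longleftrightarrow> real_function Y \<and>
     (\<forall>a \<in> real_set Y. \<exists>r::rat. r > 0 \<and> ball a (of_rat r) \<subseteq> real_set Y)"

(* The value of a functional may depend on the code of the point and on the operation Y itself,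
   and it is unconstrained on arguments that do not code an open set and one of its elements. *)
definition Phi_functional :: "((type1 \<Rightarrow> type1) \<Rightarrow> type1 \<Rightarrow> rat) \<Rightarrow> bool" where
  "Phi_functional \<Phi> \<longleftrightarrow>
     (\<forall>Y x. open_set Y \<longrightarrow> is_real x \<longrightarrow> real_val x \<in> real_set Y \<longrightarrow>
        \<Phi> Y x > 0 \<and> ball (real_val x) (of_rat (\<Phi> Y x)) \<subseteq> real_set Y)"

(* A single type-2 object F codes a pair (Y, x): x n is the value of F at the sequence 0, n, n, ...,
   and Y f n is the value of F at the sequence n + 1, f 0, f 1, ...  *)
definition fun_part :: "type2 \<Rightarrow> type1 \<Rightarrow> type1" where
  "fun_part F f n = F (case_nat (Suc n) f)"

definition point_part :: "type2 \<Rightarrow> type1" where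
  "point_part F n = F (case_nat 0 (\<lambda>_. n))"

lemma every_pair_coded:
  obtains F where "fun_part F = Y" and "point_part F = x"
proof
  define F :: type2 where
    "F h = (case h 0 of 0 \<Rightarrow> x (h 1) | Suc n \<Rightarrow> Y (\<lambda>k. h (Suc k)) n)" for h
  show "fun_part F = Y" by (rule ext)+ (simp add: fun_part_def F_def)
  show "point_part F = x" by (rule ext) (simp add: point_part_def F_def)
qed

(* Only inputs G with the same point as F are compared; by countably_based_iff below this gives
   the same notion as comparing F with all type-2 objects. *)
definition countably_based :: "((type1 \<Rightarrow> type1) \<Rightarrow> type1 \<Rightarrow> rat) \<Rightarrow> bool" where
  "countably_based \<Phi> \<longleftrightarrow>
     (\<forall>F. \<exists>X :: type1 set. countable X \<and>
        (\<forall>G. point_part G = point_part F \<longrightarrow> (\<forall>f \<in> X. G f = F f) \<longrightarrow>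
           \<Phi> (fun_part F) (point_part F) = \<Phi> (fun_part G) (point_part G)))"

lemma countably_based_iff:
  "countably_based \<Phi> \<longleftrightarrow>
     (\<forall>F. \<exists>X :: type1 set. countable X \<and>
        (\<forall>G. (\<forall>f \<in> X. G f = F f) \<longrightarrow>
           \<Phi> (fun_part F) (point_part F) = \<Phi> (fun_part G) (point_part G)))"
  (is "_ \<longleftrightarrow> ?R")
proof
  assume cb: "countably_based \<Phi>"
  show ?R
  proof
    fix F
    obtain X where X: "countable X"
      and eq: "\<And>G. point_part G = point_part F \<Longrightarrow> \<forall>f \<in> X. G f = F f \<Longrightarrow>
        \<Phi> (fun_part F) (point_part F) = \<Phi> (fun_part G) (point_part G)"
      using cb unfolding countably_based_def by blast
    define X' :: "type1 set" where "X' = X \<union> range (\<lambda>n. case_nat 0 (\<lambda>_. n))"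
    have "countable X'" using X by (simp add: X'_def)
    moreover have "\<Phi> (fun_part F) (point_part F) = \<Phi> (fun_part G) (point_part G)"
      if G: "\<forall>f \<in> X'. G f = F f" for G
    proof (rule eq)
      show "point_part G = point_part F"
        by (rule ext) (use G in \<open>simp add: point_part_def X'_def\<close>)
    qed (use G in \<open>simp add: X'_def\<close>)
    ultimately show "\<exists>X :: type1 set. countable X \<and>
        (\<forall>G. (\<forall>f \<in> X. G f = F f) \<longrightarrow>
           \<Phi> (fun_part F) (point_part F) = \<Phi> (fun_part G) (point_part G))" by blast
  qed
next
  assume ?R
  then show "countably_based \<Phi>" unfolding countably_based_def by metis
qed

end

theory Submission
  imports Defs
begin

text \<open>Let \<open>\<Phi>\<close> return the radius \<open>r\<close> on the pair \<open>(\<real>, 0)\<close>, and suppose that this value depends only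
  on a countable set \<open>X\<close> of queries. The interval \<open>(-r, r)\<close> is uncountable, so it contains some
  \<open>y \<noteq> 0\<close> that is not coded by any query in \<open>X\<close>. On \<open>X\<close> the sets \<open>\<real>\<close> and \<open>\<real> - {y}\<close> cannot be told
  apart, so \<open>\<Phi>\<close> returns \<open>r\<close> on \<open>(\<real> - {y}, 0)\<close> as well, although \<open>y\<close> lies in the ball \<open>B(0, r)\<close>.\<close>

text \<open>Rationals chosen within \<open>1 / 2 ^ Suc n\<close> of \<open>a\<close> differ pairwise
  by less than \<open>1 / 2 ^ n\<close>, the strict bound in \<open>is_real\<close>; hence the extra
  factor of two.\<close>

lemma every_real_coded:
  obtains x where "is_real x" and "real_val x = a"
proof -
  have "\<exists>k. \<bar>real_of_rat (nat_to_rat_surj k) - a\<bar> < 1 / 2 ^ Suc n" for n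
  proof -
    have "a - 1 / 2 ^ Suc n < a + 1 / 2 ^ Suc n"
      by (simp add: add_pos_pos)
    then obtain q where "a - 1 / 2 ^ Suc n < of_rat q" "of_rat q < a + 1 / 2 ^ Suc n"
      using of_rat_dense by blast
    moreover obtain k where "q = nat_to_rat_surj k"
      using surj_nat_to_rat_surj by (metis surjD)
    ultimately show ?thesis
      by (intro exI[of _ k]) (simp add: abs_less_iff)
  qed
  then obtain x where x: "\<And>n. \<bar>real_of_rat (rat_seq x n) - a\<bar> < 1 / 2 ^ Suc n"
    unfolding rat_seq_def by metis
  have "is_real x"
    unfolding is_real_def
  proof (intro allI)
    fix n i
    have "(1::real) / 2 ^ Suc (n + i) \<le> 1 / 2 ^ Suc n"
      by (intro divide_left_mono power_increasing) auto
    with x[of n] x[of "n + i"]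
    have "\<bar>real_of_rat (rat_seq x n) - real_of_rat (rat_seq x (n + i))\<bar>
        < 1 / 2 ^ Suc n + 1 / 2 ^ Suc n"
      by linarith
    also have "\<dots> = 1 / 2 ^ n" by simp
    finally have "real_of_rat \<bar>rat_seq x n - rat_seq x (n + i)\<bar> < real_of_rat (1 / 2 ^ n)"
      by (simp add: of_rat_divide of_rat_power flip: of_rat_diff)
    then show "\<bar>rat_seq x n - rat_seq x (n + i)\<bar> < 1 / 2 ^ n"
      by (simp only: of_rat_less)
  qed
  moreover have "(\<lambda>n. real_of_rat (rat_seq x n)) \<longlonglongrightarrow> a"
  proof (rule LIM_zero_cancel, rule Lim_null_comparison)
    show "\<forall>\<^sub>F n in sequentially. norm (real_of_rat (rat_seq x n) - a) \<le> (1 / 2) ^ Suc n"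
      using x by (auto simp: power_one_over less_imp_le)
    show "(\<lambda>n. (1 / 2 :: real) ^ Suc n) \<longlonglongrightarrow> 0"
      by (intro filterlim_compose[OF LIMSEQ_power_zero filterlim_Suc]) simp
  qed
  then have "real_val x = a"
    unfolding real_val_def by (rule limI)
  ultimately show thesis by (rule that)
qed

text \<open>\<open>Y\<close> looks at its argument only through \<open>real_val\<close>, so it
  respects equality of reals. It need not be continuous, so any open \<open>S\<close> can be
  realised with just two output codes.\<close>

lemma open_set_if_real_val:
  assumes "is_real c" "is_real d" "real_val c > 0" "real_val d \<le> 0" and "open S"
  defines "Y \<equiv> \<lambda>f. if real_val f \<in> S then c else d"
  shows "real_set Y = S" and "open_set Y"
proof -
  show Y: "real_set Y = S"
  proof
    show "real_set Y \<subseteq> S"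
      using assms by (auto simp: real_set_def Y_def split: if_splits)
    show "S \<subseteq> real_set Y"
    proof
      fix a assume "a \<in> S"
      moreover obtain x where "is_real x" "real_val x = a" by (rule every_real_coded)
      ultimately show "a \<in> real_set Y"
        using assms by (auto simp: real_set_def Y_def)
    qed
  qed
  have "\<exists>r::rat. r > 0 \<and> ball a (of_rat r) \<subseteq> S" if "a \<in> S" for a
  proof -
    obtain e where "e > 0" and e: "ball a e \<subseteq> S"
      using \<open>open S\<close> \<open>a \<in> S\<close> open_contains_ball by metis
    obtain r where "0 < real_of_rat r" "of_rat r < e"
      using of_rat_dense[OF \<open>e > 0\<close>] by blast
    with e show ?thesis
      by (intro exI[of _ r]) auto
  qed
  moreover have "real_function Y"
    using assms by (simp add: real_function_def Y_def)
  ultimately show "open_set Y"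
    by (simp add: open_set_def Y)
qed

text \<open>The witness from \<open>every_pair_coded\<close>, made explicit because two codes must
  be compared query by query.\<close>

definition code_pair :: "(type1 \<Rightarrow> type1) \<Rightarrow> type1 \<Rightarrow> type2" where
  "code_pair Y x h = (case h 0 of 0 \<Rightarrow> x (h 1) | Suc n \<Rightarrow> Y (\<lambda>k. h (Suc k)) n)"

lemma fun_part_code_pair [simp]: "fun_part (code_pair Y x) = Y"
  by (rule ext)+ (simp add: fun_part_def code_pair_def)

lemma point_part_code_pair [simp]: "point_part (code_pair Y x) = x"
  by (rule ext) (simp add: point_part_def code_pair_def)

theorem theorem4p14:
  fixes \<Phi> :: "((nat \<Rightarrow> nat) \<Rightarrow> (nat \<Rightarrow> nat)) \<Rightarrow> (nat \<Rightarrow> nat) \<Rightarrow> rat"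
  assumes "Phi_functional \<Phi>"
  shows "\<not> countably_based \<Phi>"
proof
  assume cb: "countably_based \<Phi>"
  obtain z where z: "is_real z" "real_val z = 0" by (rule every_real_coded)
  obtain c where c: "is_real c" "real_val c = 1" by (rule every_real_coded)
  define Y where "Y S = (\<lambda>f. if real_val f \<in> S then c else z)" for S
  have Y: "real_set (Y S) = S" "open_set (Y S)" if "open S" for S
    using open_set_if_real_val[of c z S] c z that by (auto simp: Y_def)
  have ball: "\<Phi> (Y S) z > 0 \<and> ball 0 (of_rat (\<Phi> (Y S) z)) \<subseteq> S" if "open S" "0 \<in> S" for S
    using assms Y[OF \<open>open S\<close>] z \<open>0 \<in> S\<close> unfolding Phi_functional_def by metis
  define r where "r = \<Phi> (Y UNIV) z"
  obtain X where "countable X"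
    and X: "\<And>G. point_part G = z \<Longrightarrow> \<forall>f\<in>X. G f = code_pair (Y UNIV) z f \<Longrightarrow>
      \<Phi> (fun_part G) z = r"
    using cb[unfolded countably_based_def, rule_format, of "code_pair (Y UNIV) z"]
    by (auto simp: r_def)
  \<comment> \<open>A query passes its tail to the function, hence the shift. Tails that code no
    real are included too, since \<open>Y S\<close> reads their \<open>real_val\<close> as well.
    Adding \<open>0\<close> keeps the point inside \<open>- {y}\<close>.\<close>
  define A where "A = insert 0 ((\<lambda>f. real_val (\<lambda>k. f (Suc k))) ` X)"
  have "countable A"
    using \<open>countable X\<close> by (simp add: A_def)
  moreover have "uncountable (ball (0::real) (of_rat r))"
    using ball[of UNIV] by (intro uncountable_ball) (simp add: r_def)
  ultimately have "\<not> ball 0 (of_rat r) \<subseteq> A"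
    using countable_subset by metis
  then obtain y where y: "y \<in> ball 0 (of_rat r)" "y \<notin> A" by blast
  have "\<Phi> (fun_part (code_pair (Y (- {y})) z)) z = r"
  proof (rule X)
    \<comment> \<open>A query starting with \<open>0\<close> reads only \<open>z\<close>; any other
      has a tail with value in \<open>A\<close>, hence not \<open>y\<close>, and both functions
      return \<open>c\<close> there.\<close>
    show "\<forall>f\<in>X. code_pair (Y (- {y})) z f = code_pair (Y UNIV) z f"
      using y(2) by (auto simp: code_pair_def Y_def A_def split: nat.split)
  qed simp
  then have "\<Phi> (Y (- {y})) z = r" by simp
  moreover have "0 \<in> - {y}" using y(2) by (auto simp: A_def)
  ultimately have "ball 0 (of_rat r) \<subseteq> - {y}"
    using ball[of "- {y}"] by auto
  with y(1) show False by blast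
qed

end
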